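(* Let $g$ be a positive integer and let $Y_1,Y_2$ be two $g\times g$ positive definite symmetric real matrices. Put $\Lambda_i=Y_i\,\mathbb Z^g$, a lattice in $\mathbb R^g$, and $T_i=\mathbb R^g/\Lambda_i$ for $i=1,2$, regarded as principally polarized real tori of dimension $g$. Then $T_1$ is isomorphic to $T_2$ as polarized real tori if and only if there is an element $A\in GL(g,\mathbb Z)$ such that $Y_2=A\,Y_1\,{}^tA$.
   Context: ${}^tA$ denotes the transpose of $A$. For a positive definite symmetric real $g\times g$ matrix $Y$, the real torus $T_Y=\mathbb R^g/Y\mathbb Z^g$ has associated complex torus $\mathfrak A_Y=\mathbb C^g/L_Y$ with $L_Y=\mathbb Z^g+i\,Y\mathbb Z^g$. It is a principally polarized real abelian variety with polarization the alternating form $E_Y=\mathrm{Im}\,H_Y$, where $H_Y(x,y)={}^tx\,Y^{-1}\,\overline y$ for $x,y\in\mathbb C^g$ (the form $H_Y$ is positive definite hermitian and $E_Y$ is integral on $L_Y\times L_Y$), and with real structure $\sigma_Y$ induced by complex conjugation on $\mathbb C^g$. Two polarized real tori $T_1=\mathbb R^g/\Lambda_1$ and $T_2=\mathbb R^g/\Lambda_2$, with associated complex tori $\mathbb C^g/L_i$, $L_i=\mathbb Z^g+i\Lambda_i$, polarizations $E_i$ and real structures $\sigma_i$ (complex conjugation), are said to be isomorphic as polarized real tori if there exists a $\mathbb C$-linear isomorphism $\varphi:\mathbb C^g\to\mathbb C^g$ such that $\varphi(L_1)=L_2$, $\varphi_*(E_1)=E_2$ (that is, $E_2(\varphi(x),\varphi(y))=E_1(x,y)$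 for all $x,y$), and $\varphi\circ\sigma_1\circ\varphi^{-1}=\sigma_2$. *)

theory Defs
  imports "HOL-Analysis.Analysis"
begin

text \<open>Throughout, \<open>g = CARD('n)\<close>.\<close>

definition pos_def_symmetric :: "real^'n^'n \<Rightarrow> bool" where
  "pos_def_symmetric Y \<longleftrightarrow> transpose Y = Y \<and> (\<forall>x. x \<noteq> 0 \<longrightarrow> x \<bullet> (Y *v x) > 0)"

definition int_vectors :: "(real^'n) set" where
  "int_vectors = {v. \<forall>i. v $ i \<in> \<int>}"

definition cvec :: "real^'n \<Rightarrow> complex^'n" where
  "cvec v = (\<chi> i. complex_of_real (v $ i))"

definition vec_cnj :: "complex^'n \<Rightarrow> complex^'n" where
  "vec_cnj z = (\<chi> i. cnj (z $ i))"

definition herm_form :: "real^'n^'n \<Rightarrow> complex^'n \<Rightarrow> complex^'n \<Rightarrow> complex" where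
  "herm_form Y x y =
     (\<Sum>i\<in>UNIV. x $ i * (map_matrix complex_of_real (matrix_inv Y) *v vec_cnj y) $ i)"

text \<open>
  The data of a polarized real torus \<open>\<real>\<^sup>g / \<Lambda>\<close>: the subgroup \<open>\<Lambda>\<close> of \<open>\<real>\<^sup>g\<close>, and the polarization
  as a real-valued form on \<open>\<complex>\<^sup>g\<close>. The record does not itself impose that \<open>\<Lambda>\<close> is a lattice or that the
  form is a polarization. The real structure is always complex conjugation \<^const>\<open>vec_cnj\<close>, hence
  not a field.
\<close>
record ('n::finite) polarized_real_torus =
  lattice :: "(real^'n) set"
  polarization :: "complex^'n \<Rightarrow> complex^'n \<Rightarrow> real"

definition complex_lattice :: "('n::finite) polarized_real_torus \<Rightarrow> (complex^'n) set" where
  "complex_lattice T = {cvec m + \<i> *s cvec v | m v. m \<in> int_vectors \<and> v \<in> lattice T}"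

definition torus_of_matrix :: "real^'n^'n \<Rightarrow> ('n::finite) polarized_real_torus" where
  "torus_of_matrix Y =
     \<lparr>lattice = (\<lambda>m. Y *v m) ` int_vectors, polarization = (\<lambda>x y. Im (herm_form Y x y))\<rparr>"

definition isomorphic_polarized_real_tori ::
  "('n::finite) polarized_real_torus \<Rightarrow> 'n polarized_real_torus \<Rightarrow> bool" where
  "isomorphic_polarized_real_tori T1 T2 \<longleftrightarrow>
     (\<exists>\<phi> :: complex^'n \<Rightarrow> complex^'n.
        Vector_Spaces.linear (*s) (*s) \<phi> \<and> bij \<phi> \<and>
        \<phi> ` complex_lattice T1 = complex_lattice T2 \<and>
        (\<forall>x y. polarization T2 (\<phi> x) (\<phi> y) = polarization T1 x y) \<and>
        \<phi> \<circ> vec_cnj \<circ> inv \<phi> = vec_cnj)"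

end

theory Submission
  imports Defs
begin

text \<open>
  A \<open>\<complex>\<close>-linear automorphism \<open>\<phi>\<close> of \<open>\<complex>\<^sup>g\<close> that commutes with complex conjugation is given by a real
  matrix \<open>B\<close>. Comparing real parts, \<open>\<phi>(L\<^sub>1) = L\<^sub>2\<close> forces \<open>B \<int>\<^sup>g = \<int>\<^sup>g\<close>, that is, \<open>B \<in> GL(g, \<int>)\<close>; evaluating
  the polarizations on \<open>i u\<close> and \<open>v\<close> with \<open>u\<close>, \<open>v\<close> real gives \<open>\<^sup>tB Y\<^sub>2\<^sup>-\<^sup>1 B = Y\<^sub>1\<^sup>-\<^sup>1\<close>, which is
  \<open>Y\<^sub>2 = B Y\<^sub>1 \<^sup>tB\<close>. Conversely, \<open>Y\<^sub>2 = B Y\<^sub>1 \<^sup>tB\<close> also gives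
  \<open>B Y\<^sub>1 \<int>\<^sup>g = B Y\<^sub>1 \<^sup>tB \<int>\<^sup>g = Y\<^sub>2 \<int>\<^sup>g\<close>, since \<open>\<^sup>tB\<close> is unimodular along with \<open>B\<close>.
\<close>

section \<open>Matrices\<close>

lemma matrix_inv_inverse:
  assumes "invertible A"
  shows "A ** matrix_inv A = mat 1" "matrix_inv A ** A = mat 1"
  using someI_ex[of "\<lambda>A'. A ** A' = mat 1 \<and> A' ** A = mat 1"] assms
  by (auto simp: matrix_inv_def invertible_def)

lemma pos_def_symmetric_invertible:
  assumes "pos_def_symmetric Y"
  shows "invertible Y"
proof -
  have "Y *v x \<noteq> 0" if "x \<noteq> 0" for x
    using assms that by (force simp: pos_def_symmetric_def)
  then show ?thesis
    by (metis invertible_left_inverse matrix_left_invertible_ker)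
qed

lemma map_matrix_of_int_mult:
  "map_matrix real_of_int (A ** B) = map_matrix real_of_int A ** map_matrix real_of_int B"
  by (simp add: vec_eq_iff matrix_matrix_mult_def)

lemma map_matrix_of_int_mat_1: "map_matrix real_of_int (mat 1) = mat 1"
  by (simp add: vec_eq_iff mat_def)

lemma map_matrix_of_int_eq_iff:
  "map_matrix real_of_int A = map_matrix real_of_int B \<longleftrightarrow> A = B"
  by (simp add: vec_eq_iff)

text \<open>Stated over semirings to cover integer matrices, whose invertibility is
  unimodularity.\<close>

lemma invertible_transpose_comm_semiring:
  fixes A :: "'a::comm_semiring_1^'n^'n"
  assumes "invertible A"
  shows "invertible (transpose A)"
  using assms unfolding invertible_def by (metis matrix_transpose_mul transpose_mat)

text \<open>Both equations say that \<open>transpose B ** matrix_inv Y2\<close> and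
  \<open>B ** Y1\<close> are inverse to each other, read in the two possible orders; a one-sided
  inverse of a square real matrix is two-sided.\<close>

lemma congruence_matrix_inv_iff:
  fixes B Y1 Y2 :: "real^'n^'n"
  assumes "invertible B" "invertible Y1" "invertible Y2"
  shows "transpose B ** matrix_inv Y2 ** B = matrix_inv Y1 \<longleftrightarrow> Y2 = B ** Y1 ** transpose B"
proof
  note inv = matrix_inv_inverse[OF assms(1)] matrix_inv_inverse[OF assms(2)]
    matrix_inv_inverse[OF assms(3)]
  {
    assume *: "transpose B ** matrix_inv Y2 ** B = matrix_inv Y1"
    have "(transpose B ** matrix_inv Y2) ** (B ** Y1) = mat 1"
      using * inv by (simp add: matrix_mul_assoc)
    then have "(B ** Y1) ** (transpose B ** matrix_inv Y2) = mat 1"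
      by (simp add: matrix_left_right_inverse)
    then have "(B ** Y1 ** transpose B ** matrix_inv Y2) ** Y2 = Y2"
      by (simp add: matrix_mul_assoc)
    then show "Y2 = B ** Y1 ** transpose B"
      using inv by (simp flip: matrix_mul_assoc)
  next
    assume *: "Y2 = B ** Y1 ** transpose B"
    have "(B ** Y1) ** (transpose B ** matrix_inv Y2) = mat 1"
      using * inv by (simp add: matrix_mul_assoc)
    then have "(transpose B ** matrix_inv Y2) ** (B ** Y1) = mat 1"
      by (simp add: matrix_left_right_inverse)
    then have "(transpose B ** matrix_inv Y2 ** B ** Y1) ** matrix_inv Y1 = matrix_inv Y1"
      by (simp add: matrix_mul_assoc)
    then show "transpose B ** matrix_inv Y2 ** B = matrix_inv Y1"
      using inv by (simp flip: matrix_mul_assoc)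
  }
qed

section \<open>Unimodular matrices\<close>

lemma zero_in_int_vectors: "0 \<in> int_vectors"
  by (simp add: int_vectors_def)

lemma of_int_mult_int_vectors:
  "m \<in> int_vectors \<Longrightarrow> map_matrix real_of_int A *v m \<in> int_vectors"
  by (auto simp: int_vectors_def matrix_vector_mult_def)

lemma unimodular_image_int_vectors:
  fixes A :: "int^'n^'n"
  assumes "invertible A"
  shows "(\<lambda>m. map_matrix real_of_int A *v m) ` int_vectors = int_vectors"
proof -
  obtain A' where "A ** A' = mat 1"
    using assms by (auto simp: invertible_def)
  then have "map_matrix real_of_int A ** map_matrix real_of_int A' = mat 1"
    by (metis map_matrix_of_int_mult map_matrix_of_int_mat_1)
  then have "m = map_matrix real_of_int A *v (map_matrix real_of_int A' *v m)" for m
    by (simp add: matrix_vector_mul_assoc)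
  then show ?thesis
    using of_int_mult_int_vectors by blast
qed

lemma matrix_preserving_int_vectors_is_integral:
  fixes B :: "real^'n^'n"
  assumes "\<And>m. m \<in> int_vectors \<Longrightarrow> B *v m \<in> int_vectors"
  obtains A where "B = map_matrix real_of_int A"
proof
  have "B $ i $ j \<in> \<int>" for i j
  proof -
    \<comment> \<open>This vector is column \<open>j\<close> of \<open>B\<close>.\<close>
    have "B *v axis j 1 \<in> int_vectors"
      by (rule assms) (simp add: int_vectors_def axis_def)
    then show ?thesis
      by (simp add: int_vectors_def matrix_vector_mult_basis column_def)
  qed
  \<comment> \<open>The floor only changes the type here, as every entry is already an
    integer.\<close>
  then show "B = map_matrix real_of_int (map_matrix floor B)"
    by (simp add: vec_eq_iff)
qed

text \<open>Equality of the image, rather than inclusion, makes \<open>matrix_inv B\<close> preserve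
  integer vectors too, so both matrices are integral.\<close>

lemma image_int_vectors_unimodular:
  fixes B :: "real^'n^'n"
  assumes "invertible B" and img: "(\<lambda>m. B *v m) ` int_vectors = int_vectors"
  obtains A :: "int^'n^'n" where "invertible A" "B = map_matrix real_of_int A"
proof -
  note inv = matrix_inv_inverse[OF assms(1)]
  obtain A where A: "B = map_matrix real_of_int A"
  proof (rule matrix_preserving_int_vectors_is_integral)
    show "B *v m \<in> int_vectors" if "m \<in> int_vectors" for m
      using img that by blast
  qed
  have "matrix_inv B *v m \<in> int_vectors" if "m \<in> int_vectors" for m
  proof -
    have "m \<in> (\<lambda>m. B *v m) ` int_vectors"
      unfolding img by (rule that)
    then obtain m' where "m = B *v m'" "m' \<in> int_vectors"
      by (rule imageE)
    then show ?thesis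
      by (simp add: matrix_vector_mul_assoc inv)
  qed
  then obtain A' where A': "matrix_inv B = map_matrix real_of_int A'"
    by (rule matrix_preserving_int_vectors_is_integral)
  \<comment> \<open>The inverse relations descend to the integers because the embedding into real
    matrices is injective and multiplicative.\<close>
  have "A ** A' = mat 1" "A' ** A = mat 1"
    using inv by (metis A A' map_matrix_of_int_eq_iff map_matrix_of_int_mult map_matrix_of_int_mat_1)+
  then show thesis
    using A that by (auto simp: invertible_def)
qed

section \<open>Complexification\<close>

abbreviation cmat :: "real^'n^'n \<Rightarrow> complex^'n^'n" where
  "cmat B \<equiv> map_matrix complex_of_real B"

lemma cvec_add_ii_eq_iff:
  "cvec a + \<i> *s cvec b = cvec c + \<i> *s cvec d \<longleftrightarrow> a = c \<and> b = d"
  by (auto simp: vec_eq_iff cvec_def complex_eq_iff)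

lemma cmat_mult_cvec: "cmat B *v cvec v = cvec (B *v v)"
  by (simp add: vec_eq_iff cvec_def matrix_vector_mult_def)

lemma cmat_mult_decomposition:
  "cmat B *v (cvec a + \<i> *s cvec b) = cvec (B *v a) + \<i> *s cvec (B *v b)"
  by (simp add: matrix_vector_right_distrib vector_scalar_commute cmat_mult_cvec)

lemma cmat_mult: "cmat (A ** B) = cmat A ** cmat B"
  by (simp add: vec_eq_iff matrix_matrix_mult_def)

lemma cmat_mult_vec_cnj: "cmat B *v vec_cnj z = vec_cnj (cmat B *v z)"
  by (simp add: vec_eq_iff vec_cnj_def matrix_vector_mult_def)

lemma vec_cnj_axis: "vec_cnj (axis j 1) = axis j 1"
  by (simp add: vec_eq_iff vec_cnj_def axis_def)

text \<open>Restricting to real vectors gives injectivity of \<open>B\<close>; conversely, a real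
  inverse of \<open>B\<close> complexifies.\<close>

lemma bij_cmat_mult_iff: "bij (\<lambda>z. cmat B *v z) \<longleftrightarrow> invertible B"
proof
  assume bij: "bij (\<lambda>z. cmat B *v z)"
  have "x = y" if "B *v x = B *v y" for x y
  proof -
    have "cmat B *v (cvec x + \<i> *s cvec 0) = cmat B *v (cvec y + \<i> *s cvec 0)"
      using that by (simp only: cmat_mult_decomposition)
    then have "cvec x + \<i> *s cvec 0 = cvec y + \<i> *s cvec 0"
      by (rule injD[OF bij_is_inj[OF bij]])
    then show ?thesis
      by (simp only: cvec_add_ii_eq_iff)
  qed
  then show "invertible B"
    by (metis injI invertible_left_inverse matrix_left_invertible_injective)
next
  assume "invertible B"
  then obtain B' where "B ** B' = mat 1" "B' ** B = mat 1"
    by (auto simp: invertible_def)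
  moreover have "cmat (mat 1) = mat 1"
    by (simp add: vec_eq_iff mat_def)
  ultimately have "cmat B ** cmat B' = mat 1" "cmat B' ** cmat B = mat 1"
    by (metis cmat_mult)+
  then show "bij (\<lambda>z. cmat B *v z)"
    by (intro bij_betw_byWitness[where f' = "\<lambda>z. cmat B' *v z"])
      (auto simp: matrix_vector_mul_assoc)
qed

text \<open>The standard basis vectors are fixed by conjugation, so their images, the columns of
  \<open>matrix \<phi>\<close>, are fixed too and hence real.\<close>

lemma conj_equivariant_linear_is_real:
  fixes \<phi> :: "complex^'n \<Rightarrow> complex^'n"
  assumes lin: "Vector_Spaces.linear (*s) (*s) \<phi>" and cnj: "\<And>z. \<phi> (vec_cnj z) = vec_cnj (\<phi> z)"
  obtains B where "\<phi> = (\<lambda>z. cmat B *v z)"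
proof
  have "matrix \<phi> $ i $ j \<in> \<real>" for i j
    using cnj[of "axis j 1"] unfolding vec_cnj_axis
    by (simp add: matrix_def vec_eq_iff vec_cnj_def Reals_cnj_iff)
  then have "matrix \<phi> = cmat (map_matrix Re (matrix \<phi>))"
    by (simp add: vec_eq_iff complex_eq_iff complex_is_Real_iff)
  then show "\<phi> = (\<lambda>z. cmat (map_matrix Re (matrix \<phi>)) *v z)"
    using matrix_works[OF lin] by metis
qed

section \<open>Isomorphisms of polarized real tori\<close>

lemma image_complex_lattice:
  "(\<lambda>z. cmat B *v z) ` complex_lattice T =
    {cvec m + \<i> *s cvec v | m v. m \<in> (\<lambda>m. B *v m) ` int_vectors \<and> v \<in> (\<lambda>m. B *v m) ` lattice T}"
proof -
  have "complex_lattice T = (\<lambda>(m, v). cvec m + \<i> *s cvec v) ` (int_vectors \<times> lattice T)"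
    by (auto simp: complex_lattice_def)
  then have "(\<lambda>z. cmat B *v z) ` complex_lattice T =
      (\<lambda>(m, v). cvec (B *v m) + \<i> *s cvec (B *v v)) ` (int_vectors \<times> lattice T)"
    by (simp add: image_image case_prod_unfold cmat_mult_decomposition)
  then show ?thesis
    by auto
qed

text \<open>Real and imaginary parts identify each side with a product of two sets. Containing 0
  makes all factors nonempty, so equal products have equal factors.\<close>

lemma image_complex_lattice_eq_iff:
  assumes "0 \<in> lattice T1" "0 \<in> lattice T2"
  shows "(\<lambda>z. cmat B *v z) ` complex_lattice T1 = complex_lattice T2 \<longleftrightarrow>
    (\<lambda>m. B *v m) ` int_vectors = int_vectors \<and> (\<lambda>m. B *v m) ` lattice T1 = lattice T2"
proof -
  have eq_iff: "{cvec m + \<i> *s cvec v | m v. m \<in> M \<and> v \<in> V} = {cvec m + \<i> *s cvec v | m v. m \<in> M' \<and> v \<in> V'}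
      \<longleftrightarrow> M = M' \<and> V = V'"
    if "0 \<in> M" "0 \<in> V" "0 \<in> M'" "0 \<in> V'" for M V M' V' :: "(real^'n) set"
  proof -
    have "{cvec m + \<i> *s cvec v | m v. m \<in> M \<and> v \<in> V} = (\<lambda>(m, v). cvec m + \<i> *s cvec v) ` (M \<times> V)"
      for M V :: "(real^'n) set"
      by auto
    moreover have "inj (\<lambda>(m, v). cvec m + \<i> *s cvec v :: complex^'n)"
      by (auto simp: inj_def cvec_add_ii_eq_iff)
    ultimately show ?thesis
      using that by (auto simp: inj_image_eq_iff times_eq_iff)
  qed
  have "0 \<in> (\<lambda>m. B *v m) ` S" if "0 \<in> S" for S
    using that by (metis imageI matrix_vector_mult_0_right)
  then show ?thesis
    unfolding image_complex_lattice unfolding complex_lattice_def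
    using assms zero_in_int_vectors by (intro eq_iff) auto
qed

lemma isomorphic_polarized_real_tori_iff_real_matrix:
  fixes T1 T2 :: "('n::finite) polarized_real_torus"
  assumes "0 \<in> lattice T1" "0 \<in> lattice T2"
  shows "isomorphic_polarized_real_tori T1 T2 \<longleftrightarrow>
    (\<exists>B. invertible B \<and> (\<lambda>m. B *v m) ` int_vectors = int_vectors \<and>
       (\<lambda>m. B *v m) ` lattice T1 = lattice T2 \<and>
       (\<forall>x y. polarization T2 (cmat B *v x) (cmat B *v y) = polarization T1 x y))"
    (is "_ \<longleftrightarrow> ?rhs")
proof
  assume "isomorphic_polarized_real_tori T1 T2"
  then obtain \<phi> :: "complex^'n \<Rightarrow> complex^'n" where \<phi>:
    "Vector_Spaces.linear (*s) (*s) \<phi>" "bij \<phi>"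
    "\<phi> ` complex_lattice T1 = complex_lattice T2"
    "\<forall>x y. polarization T2 (\<phi> x) (\<phi> y) = polarization T1 x y"
    "\<phi> \<circ> vec_cnj \<circ> inv \<phi> = vec_cnj"
    unfolding isomorphic_polarized_real_tori_def by blast
  have "\<phi> (vec_cnj z) = vec_cnj (\<phi> z)" for z
    \<comment> \<open>Evaluating at \<open>\<phi> z\<close> cancels
      \<open>inv \<phi>\<close>.\<close>
    using fun_cong[OF \<phi>(5), of "\<phi> z"] \<phi>(2) by (simp add: bij_is_inj)
  then obtain B where "\<phi> = (\<lambda>z. cmat B *v z)"
    using conj_equivariant_linear_is_real[OF \<phi>(1)] by blast
  with \<phi> show ?rhs
    by (metis bij_cmat_mult_iff image_complex_lattice_eq_iff[OF assms])
next
  assume ?rhs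
  then obtain B where B: "invertible B" "(\<lambda>m. B *v m) ` int_vectors = int_vectors"
    "(\<lambda>m. B *v m) ` lattice T1 = lattice T2"
    "\<forall>x y. polarization T2 (cmat B *v x) (cmat B *v y) = polarization T1 x y"
    by blast
  let ?\<phi> = "\<lambda>z. cmat B *v z"
  have bij: "bij ?\<phi>"
    using B(1) by (simp add: bij_cmat_mult_iff)
  have "?\<phi> \<circ> vec_cnj \<circ> inv ?\<phi> = vec_cnj"
    using surj_f_inv_f[OF bij_is_surj[OF bij]] by (simp add: fun_eq_iff cmat_mult_vec_cnj)
  then show "isomorphic_polarized_real_tori T1 T2"
    unfolding isomorphic_polarized_real_tori_def
    using B bij by (intro exI[of _ ?\<phi>]) (simp add: image_complex_lattice_eq_iff assms)
qed

text \<open>Adjointness for the bilinear pairing without conjugation, which is the one in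
  \<open>herm_form\<close> once its second argument has been conjugated.\<close>

lemma sum_matrix_vector_mult_transpose:
  fixes A :: "'a::comm_semiring_1^'n^'m"
  shows "(\<Sum>i\<in>UNIV. (A *v x) $ i * z $ i) = (\<Sum>j\<in>UNIV. x $ j * (transpose A *v z) $ j)"
  by (simp add: matrix_vector_mult_def transpose_def sum_distrib_left sum_distrib_right,
      subst sum.swap) (simp add: ac_simps)

lemma polarization_preserved_iff:
  fixes B Y1 Y2 :: "real^'n^'n"
  shows "(\<forall>x y. Im (herm_form Y2 (cmat B *v x) (cmat B *v y)) = Im (herm_form Y1 x y)) \<longleftrightarrow>
    transpose B ** matrix_inv Y2 ** B = matrix_inv Y1" (is "?lhs \<longleftrightarrow> ?C = _")
proof -
  \<comment> \<open>Conjugation passes through the real matrix \<open>B\<close>, and the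
    \<open>B\<close> acting on \<open>x\<close> moves across the pairing as its transpose.\<close>
  have pullback: "herm_form Y2 (cmat B *v x) (cmat B *v y) =
      (\<Sum>i\<in>UNIV. x $ i * (cmat ?C *v vec_cnj y) $ i)" for x y
  proof -
    have "transpose (cmat B) = cmat (transpose B)"
      by (simp add: vec_eq_iff transpose_def)
    then show ?thesis
      unfolding herm_form_def
      by (simp add: sum_matrix_vector_mult_transpose cmat_mult matrix_vector_mul_assoc
          matrix_mul_assoc flip: cmat_mult_vec_cnj)
  qed
  \<comment> \<open>On these arguments the sum is \<open>\<i>\<close> times a real number, so its
    imaginary part alone recovers the bilinear form of \<open>C\<close>, and thereby
    \<open>C\<close>.\<close>
  have Im_form: "Im (\<Sum>i\<in>UNIV. (\<i> *s cvec u) $ i * (cmat C *v vec_cnj (cvec v)) $ i) = u \<bullet> (C *v v)"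
    for C :: "real^'n^'n" and u v
  proof -
    have "vec_cnj (cvec v) = cvec v"
      by (simp add: vec_eq_iff vec_cnj_def cvec_def)
    then show ?thesis
      by (simp add: cmat_mult_cvec) (simp add: cvec_def inner_vec_def)
  qed
  show ?thesis
  proof
    assume ?lhs
    then have "u \<bullet> (?C *v v) = u \<bullet> (matrix_inv Y1 *v v)" for u v
      by (metis pullback Im_form herm_form_def)
    then show "?C = matrix_inv Y1"
      by (metis vector_eq_rdot inner_commute matrix_eq)
  next
    assume "?C = matrix_inv Y1"
    then show ?lhs
      unfolding pullback by (simp add: herm_form_def)
  qed
qed

theorem mainTheorem1:
  fixes Y1 Y2 :: "real^'n^'n"
  assumes "pos_def_symmetric Y1" and "pos_def_symmetric Y2"
  shows "isomorphic_polarized_real_tori (torus_of_matrix Y1) (torus_of_matrix Y2) \<longleftrightarrow>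
    (\<exists>A :: int^'n^'n. invertible A \<and>
       Y2 = map_matrix real_of_int A ** Y1 ** transpose (map_matrix real_of_int A))"
proof -
  have inv: "invertible Y1" "invertible Y2"
    using assms by (auto intro: pos_def_symmetric_invertible)
  have "0 \<in> lattice (torus_of_matrix Y)" for Y :: "real^'n^'n"
    using zero_in_int_vectors by (force simp: torus_of_matrix_def image_iff)
  then have "isomorphic_polarized_real_tori (torus_of_matrix Y1) (torus_of_matrix Y2) \<longleftrightarrow>
    (\<exists>B. invertible B \<and> (\<lambda>m. B *v m) ` int_vectors = int_vectors \<and>
       (\<lambda>m. B *v m) ` (\<lambda>m. Y1 *v m) ` int_vectors = (\<lambda>m. Y2 *v m) ` int_vectors \<and>
       transpose B ** matrix_inv Y2 ** B = matrix_inv Y1)"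
    by (simp add: isomorphic_polarized_real_tori_iff_real_matrix)
      (simp add: torus_of_matrix_def polarization_preserved_iff)
  \<comment> \<open>The congruence is rewritten under the first conjunct, which supplies the
    invertibility of \<open>B\<close>.\<close>
  also have "\<dots> \<longleftrightarrow> (\<exists>B. invertible B \<and> (\<lambda>m. B *v m) ` int_vectors = int_vectors \<and>
       (\<lambda>m. B *v m) ` (\<lambda>m. Y1 *v m) ` int_vectors = (\<lambda>m. Y2 *v m) ` int_vectors \<and>
       Y2 = B ** Y1 ** transpose B)"
    using congruence_matrix_inv_iff[OF _ inv] by (intro ex_cong1 conj_cong refl)
  also have "\<dots> \<longleftrightarrow> (\<exists>A :: int^'n^'n. invertible A \<and>
       Y2 = map_matrix real_of_int A ** Y1 ** transpose (map_matrix real_of_int A))"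
    (is "?real \<longleftrightarrow> ?int")
  proof
    assume ?real
    then show ?int
      using image_int_vectors_unimodular by metis
  next
    assume ?int
    then obtain A :: "int^'n^'n" where A: "invertible A"
      and Y2: "Y2 = map_matrix real_of_int A ** Y1 ** transpose (map_matrix real_of_int A)"
      by blast
    let ?B = "map_matrix real_of_int A"
    have "invertible ?B"
      using A unfolding invertible_def by (metis map_matrix_of_int_mult map_matrix_of_int_mat_1)
    moreover have "(\<lambda>m. ?B *v m) ` int_vectors = int_vectors"
      using A by (rule unimodular_image_int_vectors)
    moreover have "(\<lambda>m. ?B *v m) ` (\<lambda>m. Y1 *v m) ` int_vectors = (\<lambda>m. Y2 *v m) ` int_vectors"
    proof -
      have "transpose ?B = map_matrix real_of_int (transpose A)"
        by (simp add: vec_eq_iff transpose_def)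
      then have "(\<lambda>m. transpose ?B *v m) ` int_vectors = int_vectors"
        using A by (metis unimodular_image_int_vectors invertible_transpose_comm_semiring)
      \<comment> \<open>Inserting the unimodular \<open>transpose ?B\<close> leaves the integer
        vectors unchanged and completes the product to \<open>Y2\<close>.\<close>
      then have "(\<lambda>m. ?B *v m) ` (\<lambda>m. Y1 *v m) ` int_vectors =
          (\<lambda>m. ?B *v m) ` (\<lambda>m. Y1 *v m) ` (\<lambda>m. transpose ?B *v m) ` int_vectors"
        by simp
      also have "\<dots> = (\<lambda>m. Y2 *v m) ` int_vectors"
        unfolding Y2 by (simp add: image_image matrix_vector_mul_assoc matrix_mul_assoc
            del: transpose_matrix_vector)
      finally show ?thesis .
    qed
    ultimately show ?real
      using Y2 by blast
  qed
  finally show ?thesis .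
qed

end
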